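(* Let $G=(V,E)$ be an undirected graph with non-negative edge weights, let $\alpha\in(0,1)$, let $s\in V$ be a source node and let $\varepsilon\in(0,1)$. Run EdgePush with thresholds $$\theta(u,v)=\frac{\varepsilon\sqrt{\mathbf{A}_{uv}}}{\sum_{\langle x,y\rangle\in\bar E}\sqrt{\mathbf{A}_{xy}}}\qquad\text{for each }\langle u,v\rangle\in\bar E .$$ Then the output $\hat{\boldsymbol\pi}$ satisfies $\|\hat{\boldsymbol\pi}-\boldsymbol\pi_s\|_1=\sum_{t\in V}|\hat{\boldsymbol\pi}(t)-\boldsymbol\pi_s(t)|\le\varepsilon$. Moreover, when the source node $s$ is chosen at random according to the degree distribution ($\Pr[s=u]=d(u)/\|\mathbf{A}\|_1$), the expected overall running time of EdgePush is $$O\!\left(\frac{1-\alpha}{\alpha\,\varepsilon\,\|\mathbf{A}\|_1}\Big(\sum_{\langle u,v\rangle\in\bar E}\sqrt{\mathbf{A}_{uv}}\Big)^2\right).$$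
   Context: $G=(V,E)$ has $n=|V|$ nodes and $m=|E|$ edges; $\mathbf{A}$ is the symmetric weighted adjacency matrix ($\mathbf{A}_{uv}=\mathbf{A}_{vu}\ge 0$ is the weight of edge $\{u,v\}$, and $\mathbf{A}_{uv}=0$ if $\{u,v\}\notin E$). $\bar E$ is the set of $2m$ directed edges, containing both $\langle u,v\rangle$ and $\langle v,u\rangle$ for each $\{u,v\}\in E$. $N(u)$ is the set of neighbors of $u$, $d(u)=\sum_{v\in N(u)}\mathbf{A}_{uv}$ is the weighted degree (assumed positive), $\mathbf{D}=\mathrm{diag}(d(u))$, $\|\mathbf{A}\|_1=\sum_{\langle u,v\rangle\in\bar E}\mathbf{A}_{uv}$, and $\mathbf{P}=\mathbf{A}\mathbf{D}^{-1}$. For a node $x$, the Personalized PageRank (PPR) vector with source $x$ is $\boldsymbol\pi_x=\alpha(\mathbf{I}-(1-\alpha)\mathbf{P})^{-1}\mathbf{e}_x$, i.e. the solution of $\boldsymbol\pi_x=(1-\alpha)\mathbf{P}\boldsymbol\pi_x+\alpha\mathbf{e}_x$; $\boldsymbol\pi_x(t)$ is its entry at $t$. EdgePush: given thresholds $\theta(u,v)>0$ for $\langle u,v\rangle\in\bar E$, it maintains a node income vector $\mathbf q\in\mathbb R^V$ and edge expenses $\mathbf{Q}_{uv}$, initialized $\mathbf q=\mathbf e_s$, $\mathbf Q=\mathbf 0$. The edge residue is $\mathbf R_{uv}=(1-\alpha)\mathbf q(u)\mathbf A_{uv}/d(u)-\mathbf Q_{uv}$. While some $\langle u,v\rangle\in\bar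 E$ has $\mathbf R_{uv}\ge\theta(u,v)$, it picks an arbitrary such edge, sets $y=\mathbf R_{uv}$ and performs an edge-based push $\mathbf Q_{uv}\leftarrow\mathbf Q_{uv}+y$, $\mathbf q(v)\leftarrow\mathbf q(v)+y$. On termination it outputs $\hat{\boldsymbol\pi}=\alpha\mathbf q$. Running time is that of an implementation in which each edge-based push (including locating an eligible edge and all bookkeeping) costs $O(1)$ amortized time, excluding an $O(m)$ preprocessing of the graph. *)

theory Defs
  imports "HOL-Probability.Probability_Mass_Function"
begin

text \<open>
  The adjacency matrix is a function \<open>A\<close> of which only the entries indexed by \<open>V\<close> matter.
  Edges are two-element subsets of \<open>V\<close>, so there are no loops and every edge gives rise to
  exactly two directed edges.
\<close>

definition neighbors :: "'v set set \<Rightarrow> 'v \<Rightarrow> 'v set" where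
  "neighbors E u = {v. {u, v} \<in> E}"

definition dir_edges :: "'v set set \<Rightarrow> ('v \<times> 'v) set" where
  "dir_edges E = {(u, v). {u, v} \<in> E}"

definition wdeg :: "'v set set \<Rightarrow> ('v \<Rightarrow> 'v \<Rightarrow> real) \<Rightarrow> 'v \<Rightarrow> real" where
  "wdeg E A u = (\<Sum>v\<in>neighbors E u. A u v)"

definition adj_norm1 :: "'v set set \<Rightarrow> ('v \<Rightarrow> 'v \<Rightarrow> real) \<Rightarrow> real" where
  "adj_norm1 E A = (\<Sum>(u, v)\<in>dir_edges E. A u v)"

definition sqrt_sum :: "'v set set \<Rightarrow> ('v \<Rightarrow> 'v \<Rightarrow> real) \<Rightarrow> real" where
  "sqrt_sum E A = (\<Sum>(u, v)\<in>dir_edges E. sqrt (A u v))"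

definition weighted_graph :: "'v set \<Rightarrow> 'v set set \<Rightarrow> ('v \<Rightarrow> 'v \<Rightarrow> real) \<Rightarrow> bool" where
  "weighted_graph V E A \<longleftrightarrow>
     finite V \<and> V \<noteq> {} \<and>
     (\<forall>e\<in>E. e \<subseteq> V \<and> card e = 2) \<and>
     (\<forall>u\<in>V. \<forall>v\<in>V. A u v = A v u \<and> 0 \<le> A u v \<and> ({u, v} \<notin> E \<longrightarrow> A u v = 0)) \<and>
     (\<forall>u\<in>V. 0 < wdeg E A u)"

definition transition :: "'v set set \<Rightarrow> ('v \<Rightarrow> 'v \<Rightarrow> real) \<Rightarrow> 'v \<Rightarrow> 'v \<Rightarrow> real" where
  "transition E A t u = A t u / wdeg E A u"

text \<open>
  The Personalized PageRank vector with source \<open>x\<close>, as the solution of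
  \<open>p = (1 - \<alpha>) P p + \<alpha> e\<^sub>x\<close>. Vectors indexed by \<open>V\<close> are extended by zero outside \<open>V\<close>,
  which makes the solution unique as a function.
\<close>

definition ppr ::
  "'v set \<Rightarrow> 'v set set \<Rightarrow> ('v \<Rightarrow> 'v \<Rightarrow> real) \<Rightarrow> real \<Rightarrow> 'v \<Rightarrow> 'v \<Rightarrow> real" where
  "ppr V E A \<alpha> x = (THE p.
     (\<forall>t. t \<notin> V \<longrightarrow> p t = 0) \<and>
     (\<forall>t\<in>V. p t = (1 - \<alpha>) * (\<Sum>u\<in>V. transition E A t u * p u) + \<alpha> * of_bool (t = x)))"

text \<open>A state of EdgePush is a pair of the node income vector and the edge expenses.\<close>

type_synonym 'v ep_state = "('v \<Rightarrow> real) \<times> ('v \<Rightarrow> 'v \<Rightarrow> real)"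

definition ep_init :: "'v \<Rightarrow> 'v ep_state" where
  "ep_init s = ((\<lambda>u. of_bool (u = s)), (\<lambda>u v. 0))"

definition residue ::
  "'v set set \<Rightarrow> ('v \<Rightarrow> 'v \<Rightarrow> real) \<Rightarrow> real \<Rightarrow> 'v ep_state \<Rightarrow> 'v \<Rightarrow> 'v \<Rightarrow> real" where
  "residue E A \<alpha> \<sigma> u v = (1 - \<alpha>) * fst \<sigma> u * A u v / wdeg E A u - snd \<sigma> u v"

definition push_edge :: "'v \<Rightarrow> 'v \<Rightarrow> real \<Rightarrow> 'v ep_state \<Rightarrow> 'v ep_state" where
  "push_edge u v y \<sigma> =
     ((fst \<sigma>)(v := fst \<sigma> v + y), (snd \<sigma>)(u := (snd \<sigma> u)(v := snd \<sigma> u v + y)))"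

definition eligible ::
  "'v set set \<Rightarrow> ('v \<Rightarrow> 'v \<Rightarrow> real) \<Rightarrow> real \<Rightarrow> ('v \<Rightarrow> 'v \<Rightarrow> real) \<Rightarrow>
   'v ep_state \<Rightarrow> 'v \<Rightarrow> 'v \<Rightarrow> bool" where
  "eligible E A \<alpha> \<theta> \<sigma> u v \<longleftrightarrow> (u, v) \<in> dir_edges E \<and> \<theta> u v \<le> residue E A \<alpha> \<sigma> u v"

text \<open>The arbitrary choice of an eligible edge is rendered by a nondeterministic step relation.\<close>

definition ep_step ::
  "'v set set \<Rightarrow> ('v \<Rightarrow> 'v \<Rightarrow> real) \<Rightarrow> real \<Rightarrow> ('v \<Rightarrow> 'v \<Rightarrow> real) \<Rightarrow>
   'v ep_state \<Rightarrow> 'v ep_state \<Rightarrow> bool" where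
  "ep_step E A \<alpha> \<theta> \<sigma> \<sigma>' \<longleftrightarrow>
     (\<exists>u v. eligible E A \<alpha> \<theta> \<sigma> u v \<and> \<sigma>' = push_edge u v (residue E A \<alpha> \<sigma> u v) \<sigma>)"

definition edgepush_run ::
  "'v set set \<Rightarrow> ('v \<Rightarrow> 'v \<Rightarrow> real) \<Rightarrow> real \<Rightarrow> ('v \<Rightarrow> 'v \<Rightarrow> real) \<Rightarrow>
   'v \<Rightarrow> nat \<Rightarrow> 'v ep_state \<Rightarrow> bool" where
  "edgepush_run E A \<alpha> \<theta> s k \<sigma> \<longleftrightarrow>
     (ep_step E A \<alpha> \<theta> ^^ k) (ep_init s) \<sigma> \<and> (\<nexists>u v. eligible E A \<alpha> \<theta> \<sigma> u v)"

definition edgepush_terminates ::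
  "'v set set \<Rightarrow> ('v \<Rightarrow> 'v \<Rightarrow> real) \<Rightarrow> real \<Rightarrow> ('v \<Rightarrow> 'v \<Rightarrow> real) \<Rightarrow> 'v \<Rightarrow> bool" where
  "edgepush_terminates E A \<alpha> \<theta> s \<longleftrightarrow>
     (\<nexists>f :: nat \<Rightarrow> 'v ep_state. f 0 = ep_init s \<and> (\<forall>i. ep_step E A \<alpha> \<theta> (f i) (f (Suc i))))"

definition edgepush_output ::
  "'v set set \<Rightarrow> ('v \<Rightarrow> 'v \<Rightarrow> real) \<Rightarrow> real \<Rightarrow> ('v \<Rightarrow> 'v \<Rightarrow> real) \<Rightarrow>
   'v \<Rightarrow> ('v \<Rightarrow> real) \<Rightarrow> bool" where
  "edgepush_output E A \<alpha> \<theta> s p \<longleftrightarrow>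
     (\<exists>k \<sigma>. edgepush_run E A \<alpha> \<theta> s k \<sigma> \<and> p = (\<lambda>t. \<alpha> * fst \<sigma> t))"

text \<open>
  \<open>t\<close> is a possible running time (without the preprocessing of the graph) of a complete
  execution from source \<open>s\<close>, in an implementation whose amortized cost per push is at
  most \<open>c\<close>: an execution with \<open>k\<close> pushes takes total time at most \<open>c * k\<close>.
\<close>

definition edgepush_running_time ::
  "real \<Rightarrow> 'v set set \<Rightarrow> ('v \<Rightarrow> 'v \<Rightarrow> real) \<Rightarrow> real \<Rightarrow> ('v \<Rightarrow> 'v \<Rightarrow> real) \<Rightarrow>
   'v \<Rightarrow> real \<Rightarrow> bool" where
  "edgepush_running_time c E A \<alpha> \<theta> s t \<longleftrightarrow>
     (\<exists>k \<sigma>. edgepush_run E A \<alpha> \<theta> s k \<sigma> \<and> 0 \<le> t \<and> t \<le> c * real k)"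

definition sqrt_threshold ::
  "'v set set \<Rightarrow> ('v \<Rightarrow> 'v \<Rightarrow> real) \<Rightarrow> real \<Rightarrow> 'v \<Rightarrow> 'v \<Rightarrow> real" where
  "sqrt_threshold E A \<epsilon> u v = \<epsilon> * sqrt (A u v) / sqrt_sum E A"

definition degree_pmf :: "'v set \<Rightarrow> 'v set set \<Rightarrow> ('v \<Rightarrow> 'v \<Rightarrow> real) \<Rightarrow> 'v pmf" where
  "degree_pmf V E A = embed_pmf (\<lambda>u. if u \<in> V then wdeg E A u / adj_norm1 E A else 0)"

text \<open>
  The parameters of a run. EdgePush takes strictly positive thresholds; on an edge of weight
  zero the threshold and the residue would both be zero and the edge would stay eligible forever.
\<close>

definition edgepush_instance ::
  "'v set \<Rightarrow> 'v set set \<Rightarrow> ('v \<Rightarrow> 'v \<Rightarrow> real) \<Rightarrow> real \<Rightarrow> real \<Rightarrow> bool" where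
  "edgepush_instance V E A \<alpha> \<epsilon> \<longleftrightarrow>
     weighted_graph V E A \<and> 0 < \<alpha> \<and> \<alpha> < 1 \<and> 0 < \<epsilon> \<and> \<epsilon> < 1 \<and>
     (\<forall>(u, v)\<in>dir_edges E. 0 < sqrt_threshold E A \<epsilon> u v)"

end

theory Submission
  imports Defs
begin

text \<open>
  The income vector \<open>q\<close> and the residue matrix \<open>R\<close> always satisfy
  \<open>q = (1 - \<alpha>) P q + e\<^sub>s - R\<^sup>T 1\<close> with \<open>R \<ge> 0\<close>, so the error \<open>\<pi>\<^sub>s - \<alpha> q\<close> solves the
  PageRank equation with right-hand side \<open>\<alpha> R\<^sup>T 1\<close>. As \<open>P\<close> is nonnegative and column-stochastic,
  the error is nonnegative and its \<open>\<ell>\<^sub>1\<close> norm is the total residue, which at termination is at most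
  the sum of the thresholds, i.e. \<open>\<epsilon>\<close>.

  A push along \<open>(u, v)\<close> increases \<open>Q\<^sub>u\<^sub>v\<close> by at least \<open>\<theta>(u, v)\<close>, while \<open>R \<ge> 0\<close> gives
  \<open>Q\<^sub>u\<^sub>v \<le> (1 - \<alpha>) q(u) A\<^sub>u\<^sub>v / d(u) \<le> (1 - \<alpha>) \<pi>\<^sub>s(u) A\<^sub>u\<^sub>v / (\<alpha> d(u))\<close>. This bounds the number of
  pushes, and the expectation follows because the degree distribution is stationary:
  \<open>\<Sum>\<^sub>s d(s) \<pi>\<^sub>s(u) = d(u)\<close>.
\<close>

section \<open>Weighted graphs and the transition matrix\<close>

text \<open>Only the graph and \<alpha> are fixed. Thresholds remain parameters of the lemmas, so
  that the analysis covers every positive \<theta>; the square-root choice enters only at the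
  end.\<close>

locale pagerank_graph =
  fixes V :: "'v set" and E :: "'v set set" and A :: "'v \<Rightarrow> 'v \<Rightarrow> real" and \<alpha> :: real
  assumes graph: "weighted_graph V E A"
    and alpha_pos: "0 < \<alpha>" and alpha_less: "\<alpha> < 1"
begin

abbreviation "P \<equiv> transition E A"

lemma finite_V: "finite V"
  using graph by (simp add: weighted_graph_def)

lemma A_sym: "u \<in> V \<Longrightarrow> v \<in> V \<Longrightarrow> A u v = A v u"
  and A_nonneg: "u \<in> V \<Longrightarrow> v \<in> V \<Longrightarrow> 0 \<le> A u v"
  and A_no_edge: "u \<in> V \<Longrightarrow> v \<in> V \<Longrightarrow> (u, v) \<notin> dir_edges E \<Longrightarrow> A u v = 0"
  and wdeg_pos: "u \<in> V \<Longrightarrow> 0 < wdeg E A u"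
  using graph by (auto simp: weighted_graph_def dir_edges_def)

lemma edge_in_V: "(u, v) \<in> dir_edges E \<Longrightarrow> u \<in> V \<and> v \<in> V"
  using graph by (auto simp: weighted_graph_def dir_edges_def)

lemma neighbors_subset: "neighbors E u \<subseteq> V"
  using edge_in_V by (auto simp: neighbors_def dir_edges_def)

lemma finite_dir_edges: "finite (dir_edges E)"
  by (rule finite_subset[of _ "V \<times> V"]) (use edge_in_V finite_V in auto)

lemma sum_dir_edges:
  "(\<Sum>(u, v)\<in>dir_edges E. f u v) = (\<Sum>u\<in>V. \<Sum>v\<in>neighbors E u. (f u v :: real))"
proof -
  have "dir_edges E = (SIGMA u:V. neighbors E u)"
    using edge_in_V by (auto simp: neighbors_def dir_edges_def)
  moreover have "finite (neighbors E u)" for u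
    using neighbors_subset finite_V finite_subset by blast
  ultimately show ?thesis
    by (simp add: sum.Sigma finite_V)
qed

lemma sum_dir_edges_eq_sum_V:
  assumes "\<And>u v. u \<in> V \<Longrightarrow> v \<in> V \<Longrightarrow> (u, v) \<notin> dir_edges E \<Longrightarrow> f u v = (0::real)"
  shows "(\<Sum>(u, v)\<in>dir_edges E. f u v) = (\<Sum>u\<in>V. \<Sum>v\<in>V. f u v)"
  unfolding sum.cartesian_product
  by (rule sum.mono_neutral_left) (use assms finite_V edge_in_V in auto)

lemma wdeg_eq_sum_V: "u \<in> V \<Longrightarrow> wdeg E A u = (\<Sum>v\<in>V. A u v)"
  unfolding wdeg_def
  by (rule sum.mono_neutral_left)
    (use finite_V neighbors_subset A_no_edge in \<open>auto simp: neighbors_def dir_edges_def\<close>)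

lemma adj_norm1_eq: "adj_norm1 E A = (\<Sum>u\<in>V. wdeg E A u)"
  by (simp add: adj_norm1_def sum_dir_edges wdeg_def)

lemma adj_norm1_pos: "0 < adj_norm1 E A"
  unfolding adj_norm1_eq
  by (rule sum_pos) (use graph in \<open>auto simp: weighted_graph_def\<close>)

lemma P_nonneg: "t \<in> V \<Longrightarrow> u \<in> V \<Longrightarrow> 0 \<le> P t u"
  using A_nonneg wdeg_pos by (simp add: transition_def less_imp_le)

lemma P_column_sum: "u \<in> V \<Longrightarrow> (\<Sum>t\<in>V. P t u) = 1"
proof -
  assume u: "u \<in> V"
  have "(\<Sum>t\<in>V. P t u) = (\<Sum>t\<in>V. A u t) / wdeg E A u"
    by (simp add: transition_def sum_divide_distrib A_sym[OF _ u])
  with wdeg_pos[OF u] show ?thesis by (simp add: wdeg_eq_sum_V[OF u])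
qed

text \<open>Exchanging the sums leaves the column sums of \<open>P\<close>, which are 1. Hence
  applying \<open>(1 - \<alpha>) P\<close> scales total mass by exactly 1 - \<alpha>, the
  contraction behind all the mass arguments below.\<close>

lemma P_preserves_mass: "(\<Sum>t\<in>V. \<Sum>u\<in>V. P t u * f u) = (\<Sum>u\<in>V. f u)"
  by (subst sum.swap) (simp add: sum_distrib_right[symmetric] P_column_sum)

section \<open>Comparison and uniqueness for the PageRank equation\<close>

text \<open>The negative part \<open>e\<close> of a supersolution satisfies \<open>e \<le> (1 - \<alpha>) P e\<close>, so its mass vanishes.\<close>

lemma supersolution_nonneg:
  assumes "\<And>t. t \<in> V \<Longrightarrow> (1 - \<alpha>) * (\<Sum>u\<in>V. P t u * f u) \<le> f t"
    and "t \<in> V"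
  shows "0 \<le> f t"
proof -
  define e where "e t = max 0 (- f t)" for t
  have e0: "0 \<le> e t" for t by (simp add: e_def)
  have "e t \<le> (1 - \<alpha>) * (\<Sum>u\<in>V. P t u * e u)" if t: "t \<in> V" for t
  proof -
    have "- (\<Sum>u\<in>V. P t u * f u) \<le> (\<Sum>u\<in>V. P t u * e u)"
      unfolding sum_negf[symmetric]
    proof (rule sum_mono)
      fix u assume "u \<in> V"
      then have "P t u * (- f u) \<le> P t u * e u"
        by (intro mult_left_mono) (auto simp: e_def P_nonneg t)
      then show "- (P t u * f u) \<le> P t u * e u" by simp
    qed
    then have "(1 - \<alpha>) * (- (\<Sum>u\<in>V. P t u * f u)) \<le> (1 - \<alpha>) * (\<Sum>u\<in>V. P t u * e u)"
      using alpha_less by (intro mult_left_mono) auto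
    moreover have "0 \<le> (1 - \<alpha>) * (\<Sum>u\<in>V. P t u * e u)"
      using alpha_less t by (intro mult_nonneg_nonneg sum_nonneg P_nonneg e0) auto
    ultimately show ?thesis using assms(1)[OF t] by (simp add: e_def)
  qed
  then have "(\<Sum>t\<in>V. e t) \<le> (\<Sum>t\<in>V. (1 - \<alpha>) * (\<Sum>u\<in>V. P t u * e u))"
    by (rule sum_mono)
  also have "\<dots> = (1 - \<alpha>) * (\<Sum>t\<in>V. e t)"
    by (simp add: sum_distrib_left[symmetric] P_preserves_mass)
  \<comment> \<open>The mass M of \<open>e\<close> satisfies M \<le> (1 - \<alpha>) M.\<close>
  finally have "\<alpha> * (\<Sum>t\<in>V. e t) \<le> 0" by (simp add: algebra_simps)
  moreover have "0 \<le> (\<Sum>t\<in>V. e t)" by (simp add: sum_nonneg e0)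
  ultimately have "(\<Sum>t\<in>V. e t) = 0"
    using alpha_pos by (simp add: mult_le_0_iff)
  then have "e t = 0"
    using sum_nonneg_eq_0_iff[OF finite_V, of e] e0 assms(2) by simp
  then show ?thesis by (simp add: e_def max_def split: if_splits)
qed

text \<open>The source term \<open>b\<close> cancels in the difference of two solutions, so both
  \<open>f - g\<close> and \<open>g - f\<close> are supersolutions of the homogeneous equation.
  Keeping \<open>b\<close> general serves PageRank vectors and the degree vector alike.\<close>

lemma pagerank_equation_unique:
  assumes "\<And>t. t \<in> V \<Longrightarrow> f t = (1 - \<alpha>) * (\<Sum>u\<in>V. P t u * f u) + b t"
    and "\<And>t. t \<in> V \<Longrightarrow> g t = (1 - \<alpha>) * (\<Sum>u\<in>V. P t u * g u) + b t"
    and "t \<in> V"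
  shows "f t = g t"
proof -
  have le: "g t \<le> f t"
    if "\<And>t. t \<in> V \<Longrightarrow> f t = (1 - \<alpha>) * (\<Sum>u\<in>V. P t u * f u) + b t"
      and "\<And>t. t \<in> V \<Longrightarrow> g t = (1 - \<alpha>) * (\<Sum>u\<in>V. P t u * g u) + b t" for f g
  proof -
    have "0 \<le> f t - g t"
    proof (rule supersolution_nonneg[OF _ assms(3)])
      fix t assume "t \<in> V"
      then show "(1 - \<alpha>) * (\<Sum>u\<in>V. P t u * (f u - g u)) \<le> f t - g t"
        by (subst that(1), assumption, subst that(2), assumption)
          (simp add: right_diff_distrib sum_subtractf)
    qed
    then show ?thesis by simp
  qed
  show ?thesis
    using le[of f g, OF assms(1,2)] le[of g f, OF assms(2,1)] by simp
qed

section \<open>Existence of PageRank vectors\<close>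

text \<open>The vector \<open>((1 - \<alpha>) P)^k e_x\<close>: the distribution of a k-step random
  walk from \<open>x\<close>, scaled by \<open>(1 - \<alpha>)^k\<close>. These are the terms of the
  Neumann series of \<open>(I - (1 - \<alpha>) P)^(-1) e_x\<close>.\<close>

primrec discounted_walk :: "'v \<Rightarrow> nat \<Rightarrow> 'v \<Rightarrow> real" where
  "discounted_walk x 0 t = of_bool (t = x)"
| "discounted_walk x (Suc k) t = (1 - \<alpha>) * (\<Sum>u\<in>V. P t u * discounted_walk x k u)"

lemma discounted_walk_nonneg: "t \<in> V \<Longrightarrow> 0 \<le> discounted_walk x k t"
proof (induction k arbitrary: t)
  case (Suc k)
  then show ?case using alpha_less
    by (auto intro!: mult_nonneg_nonneg sum_nonneg P_nonneg)
qed simp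

lemma discounted_walk_mass:
  assumes "x \<in> V"
  shows "(\<Sum>t\<in>V. discounted_walk x k t) = (1 - \<alpha>) ^ k"
proof (induction k)
  case 0
  then show ?case using assms finite_V by (simp add: of_bool_def)
next
  case (Suc k)
  then show ?case by (simp add: sum_distrib_left[symmetric] P_preserves_mass)
qed

text \<open>A single entry of a nonnegative vector is at most its total mass, which decays
  geometrically.\<close>

lemma summable_discounted_walk:
  assumes "x \<in> V" "t \<in> V"
  shows "summable (\<lambda>k. discounted_walk x k t)"
proof (rule summable_comparison_test'[where g = "\<lambda>k. (1 - \<alpha>) ^ k" and N = 0])
  show "summable (\<lambda>k. (1 - \<alpha>) ^ k)"
    using alpha_pos alpha_less by (intro summable_geometric) simp
  show "norm (discounted_walk x k t) \<le> (1 - \<alpha>) ^ k" for k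
    using member_le_sum[OF assms(2), of "discounted_walk x k"] finite_V
    by (simp add: discounted_walk_nonneg assms discounted_walk_mass)
qed

lemma ppr_solution_exists:
  assumes x: "x \<in> V"
  shows "\<exists>p. (\<forall>t. t \<notin> V \<longrightarrow> p t = 0) \<and>
    (\<forall>t\<in>V. p t = (1 - \<alpha>) * (\<Sum>u\<in>V. P t u * p u) + \<alpha> * of_bool (t = x))"
proof -
  define w where "w t = (\<Sum>k. discounted_walk x k t)" for t
  have w: "w t = (1 - \<alpha>) * (\<Sum>u\<in>V. P t u * w u) + of_bool (t = x)" if t: "t \<in> V" for t
  proof -
    have s: "summable (\<lambda>k. P t u * discounted_walk x k u)" if "u \<in> V" for u
      by (intro summable_mult summable_discounted_walk x that)
    \<comment> \<open>The term for k = 0 is the source; the shifted series is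
      \<open>(1 - \<alpha>) P\<close> applied to the whole series.\<close>
    have "w t = (\<Sum>k. discounted_walk x (Suc k) t) + of_bool (t = x)"
      using suminf_split_head[OF summable_discounted_walk[OF x t]] by (simp add: w_def)
    also have "(\<Sum>k. discounted_walk x (Suc k) t)
        = (1 - \<alpha>) * (\<Sum>k. \<Sum>u\<in>V. P t u * discounted_walk x k u)"
      by (simp only: discounted_walk.simps) (intro suminf_mult summable_sum s)
    also have "(\<Sum>k. \<Sum>u\<in>V. P t u * discounted_walk x k u) = (\<Sum>u\<in>V. P t u * w u)"
      by (simp add: suminf_sum s w_def suminf_mult summable_discounted_walk x)
    finally show ?thesis .
  qed
  have "\<alpha> * w t = (1 - \<alpha>) * (\<Sum>u\<in>V. P t u * (\<alpha> * w u)) + \<alpha> * of_bool (t = x)"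
    if "t \<in> V" for t
    by (subst w[OF that]) (simp add: algebra_simps sum_distrib_left)
  then show ?thesis
    by (intro exI[of _ "\<lambda>t. if t \<in> V then \<alpha> * w t else 0"]) simp
qed

text \<open>Resolves the definite description in \<open>ppr\<close>. Uniqueness on \<open>V\<close>
  becomes equality of functions because solutions vanish outside \<open>V\<close>.\<close>

lemma ppr_equation:
  assumes "x \<in> V" "t \<in> V"
  shows "ppr V E A \<alpha> x t
    = (1 - \<alpha>) * (\<Sum>u\<in>V. P t u * ppr V E A \<alpha> x u) + \<alpha> * of_bool (t = x)"
proof -
  have "\<exists>!p. (\<forall>t. t \<notin> V \<longrightarrow> p t = 0) \<and>
    (\<forall>t\<in>V. p t = (1 - \<alpha>) * (\<Sum>u\<in>V. P t u * p u) + \<alpha> * of_bool (t = x))"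
  proof (rule ex_ex1I[OF ppr_solution_exists[OF assms(1)]])
    fix p p'
    assume p: "(\<forall>t. t \<notin> V \<longrightarrow> p t = 0) \<and>
      (\<forall>t\<in>V. p t = (1 - \<alpha>) * (\<Sum>u\<in>V. P t u * p u) + \<alpha> * of_bool (t = x))"
      and p': "(\<forall>t. t \<notin> V \<longrightarrow> p' t = 0) \<and>
      (\<forall>t\<in>V. p' t = (1 - \<alpha>) * (\<Sum>u\<in>V. P t u * p' u) + \<alpha> * of_bool (t = x))"
    show "p = p'"
    proof
      fix t
      show "p t = p' t"
      proof (cases "t \<in> V")
        case True
        show ?thesis
          by (rule pagerank_equation_unique[where b = "\<lambda>t. \<alpha> * of_bool (t = x)", OF _ _ True])
            (use p p' in blast)+
      qed (use p p' in simp)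
    qed
  qed
  from theI'[OF this, folded ppr_def] assms(2) show ?thesis by blast
qed

section \<open>The degree distribution\<close>

text \<open>Both sides solve \<open>f = (1 - \<alpha>) P f + \<alpha> d\<close> with
  \<open>d\<close> the degree vector: the left side by linearity in the source, the right side
  because \<open>P d = d\<close>, as \<open>P D = A\<close> and the row sums of \<open>A\<close> are
  the degrees.\<close>

lemma ppr_degree_stationary:
  assumes "u \<in> V"
  shows "(\<Sum>s\<in>V. wdeg E A s * ppr V E A \<alpha> s u) = wdeg E A u"
proof (rule pagerank_equation_unique[where b = "\<lambda>t. \<alpha> * wdeg E A t", OF _ _ assms])
  fix t assume t: "t \<in> V"
  have "(\<Sum>s\<in>V. wdeg E A s * ppr V E A \<alpha> s t)
      = (\<Sum>s\<in>V. (1 - \<alpha>) * (\<Sum>u\<in>V. P t u * (wdeg E A s * ppr V E A \<alpha> s u))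
          + \<alpha> * (wdeg E A s * of_bool (t = s)))"
  proof (rule sum.cong[OF refl])
    fix s assume "s \<in> V"
    show "wdeg E A s * ppr V E A \<alpha> s t
      = (1 - \<alpha>) * (\<Sum>u\<in>V. P t u * (wdeg E A s * ppr V E A \<alpha> s u))
          + \<alpha> * (wdeg E A s * of_bool (t = s))"
      by (subst ppr_equation[OF \<open>s \<in> V\<close> t])
        (simp add: distrib_left sum_distrib_left mult_ac)
  qed
  also have "\<dots> = (1 - \<alpha>) * (\<Sum>s\<in>V. \<Sum>u\<in>V. P t u * (wdeg E A s * ppr V E A \<alpha> s u))
      + \<alpha> * (\<Sum>s\<in>V. wdeg E A s * of_bool (t = s))"
    by (simp add: sum.distrib sum_distrib_left)
  also have "(\<Sum>s\<in>V. wdeg E A s * of_bool (t = s)) = wdeg E A t"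
    using t finite_V by (simp add: of_bool_def if_distrib cong: if_cong)
  also have "(\<Sum>s\<in>V. \<Sum>u\<in>V. P t u * (wdeg E A s * ppr V E A \<alpha> s u))
      = (\<Sum>u\<in>V. P t u * (\<Sum>s\<in>V. wdeg E A s * ppr V E A \<alpha> s u))"
    by (subst sum.swap) (simp add: sum_distrib_left)
  finally show "(\<Sum>s\<in>V. wdeg E A s * ppr V E A \<alpha> s t)
      = (1 - \<alpha>) * (\<Sum>u\<in>V. P t u * (\<Sum>s\<in>V. wdeg E A s * ppr V E A \<alpha> s u)) + \<alpha> * wdeg E A t" .
next
  fix t assume t: "t \<in> V"
  have "(\<Sum>u\<in>V. P t u * wdeg E A u) = (\<Sum>u\<in>V. A t u)"
  proof (rule sum.cong[OF refl])
    fix u assume "u \<in> V"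
    then show "P t u * wdeg E A u = A t u"
      using wdeg_pos[of u] by (simp add: transition_def)
  qed
  then show "wdeg E A t = (1 - \<alpha>) * (\<Sum>u\<in>V. P t u * wdeg E A u) + \<alpha> * wdeg E A t"
    by (simp add: wdeg_eq_sum_V[OF t] algebra_simps)
qed

text \<open>\<open>embed_pmf\<close> is meaningful only for nonnegative weights of total mass 1;
  both are checked here.\<close>

lemma pmf_degree_pmf:
  "pmf (degree_pmf V E A) u = (if u \<in> V then wdeg E A u / adj_norm1 E A else 0)"
  unfolding degree_pmf_def
proof (rule pmf_embed_pmf)
  let ?f = "\<lambda>u. if u \<in> V then wdeg E A u / adj_norm1 E A else 0"
  show "0 \<le> ?f u" for u
    using wdeg_pos adj_norm1_pos by (simp add: less_imp_le)
  have "(\<integral>\<^sup>+ u. ennreal (?f u) \<partial>count_space UNIV) = (\<Sum>u\<in>V. ennreal (?f u))"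
    by (rule nn_integral_count_space'[OF finite_V]) auto
  also have "\<dots> = ennreal (\<Sum>u\<in>V. wdeg E A u / adj_norm1 E A)"
    using wdeg_pos adj_norm1_pos by (subst sum_ennreal[symmetric]) (auto simp: less_imp_le)
  also have "\<dots> = 1"
    using adj_norm1_pos by (simp add: sum_divide_distrib[symmetric] adj_norm1_eq[symmetric])
  finally show "(\<integral>\<^sup>+ u. ennreal (?f u) \<partial>count_space UNIV) = 1" .
qed

text \<open>The support lies in the finite set \<open>V\<close>, so the integral is a finite sum and
  values of \<open>f\<close> outside \<open>V\<close> do not matter.\<close>

lemma expectation_degree_pmf:
  "measure_pmf.expectation (degree_pmf V E A) f
    = (\<Sum>s\<in>V. wdeg E A s * f s) / adj_norm1 E A"
proof -
  have "measure_pmf.expectation (degree_pmf V E A) f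
      = (\<Sum>s\<in>V. f s * pmf (degree_pmf V E A) s)"
    by (rule integral_measure_pmf_real[OF finite_V])
      (auto simp: set_pmf_iff pmf_degree_pmf split: if_splits)
  also have "\<dots> = (\<Sum>s\<in>V. wdeg E A s * f s) / adj_norm1 E A"
    by (simp add: pmf_degree_pmf sum_divide_distrib mult_ac)
  finally show ?thesis .
qed

section \<open>The invariant of EdgePush and the push potential\<close>

text \<open>The first clause is conservation: income is the initial unit plus everything received.
  The second confines expenses to edges, so that sums over pairs in \<open>V\<close> and over
  directed edges agree.\<close>

definition ep_invariant :: "'v \<Rightarrow> 'v ep_state \<Rightarrow> bool" where
  "ep_invariant s \<sigma> \<longleftrightarrow>
     (\<forall>t\<in>V. fst \<sigma> t = of_bool (t = s) + (\<Sum>u\<in>V. snd \<sigma> u t)) \<and>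
     (\<forall>u v. (u, v) \<notin> dir_edges E \<longrightarrow> snd \<sigma> u v = 0) \<and>
     (\<forall>u\<in>V. \<forall>v\<in>V. 0 \<le> residue E A \<alpha> \<sigma> u v)"

lemma ep_invariant_init: "s \<in> V \<Longrightarrow> ep_invariant s (ep_init s)"
  using alpha_less A_nonneg wdeg_pos
  by (auto simp: ep_invariant_def ep_init_def residue_def less_imp_le)

text \<open>A push clears the residue of its own edge and raises the income of \<open>b\<close>,
  which can only increase the residues of edges leaving \<open>b\<close>.\<close>

lemma ep_invariant_step:
  assumes inv: "ep_invariant s \<sigma>"
    and pos: "\<And>u v. (u, v) \<in> dir_edges E \<Longrightarrow> 0 < \<theta> u v"
    and step: "ep_step E A \<alpha> \<theta> \<sigma> \<sigma>'"
  shows "ep_invariant s \<sigma>'"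
proof -
  obtain a b where ab: "(a, b) \<in> dir_edges E" "\<theta> a b \<le> residue E A \<alpha> \<sigma> a b"
    and \<sigma>': "\<sigma>' = push_edge a b (residue E A \<alpha> \<sigma> a b) \<sigma>"
    using step by (auto simp: ep_step_def eligible_def)
  define y where "y = residue E A \<alpha> \<sigma> a b"
  have y: "0 < y" using pos[OF ab(1)] ab(2) by (simp add: y_def)
  have V: "a \<in> V" "b \<in> V" using edge_in_V[OF ab(1)] by auto
  \<comment> \<open>Without loops the push leaves the income of \<open>a\<close> unchanged, so the
    residue of the pushed edge becomes exactly 0.\<close>
  have "a \<noteq> b" using ab(1) graph by (auto simp: weighted_graph_def dir_edges_def)
  have q': "fst \<sigma>' t = fst \<sigma> t + (if t = b then y else 0)" for t
    by (simp add: \<sigma>' push_edge_def y_def)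
  \<comment> \<open>Isolating \<open>u = a\<close> in the outer conditional lets the sum over
    \<open>u\<close> collapse to one term.\<close>
  have Q': "snd \<sigma>' u t = snd \<sigma> u t + (if u = a then if t = b then y else 0 else 0)" for u t
    by (simp add: \<sigma>' push_edge_def y_def)
  have "fst \<sigma>' t = of_bool (t = s) + (\<Sum>u\<in>V. snd \<sigma>' u t)" if "t \<in> V" for t
    using inv that finite_V V(1) by (simp add: ep_invariant_def q' Q' sum.distrib)
  moreover have "snd \<sigma>' u v = 0" if "(u, v) \<notin> dir_edges E" for u v
    using inv that ab(1) by (auto simp: ep_invariant_def Q')
  moreover have "0 \<le> residue E A \<alpha> \<sigma>' u v" if uv: "u \<in> V" "v \<in> V" for u v
  proof -
    have R: "0 \<le> residue E A \<alpha> \<sigma> u v" using inv uv by (simp add: ep_invariant_def)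
    show ?thesis
    proof (cases "(u, v) = (a, b)")
      case True
      then show ?thesis using \<open>a \<noteq> b\<close> by (simp add: residue_def q' Q' y_def)
    next
      case False
      have "(1 - \<alpha>) * fst \<sigma> u * A u v / wdeg E A u \<le> (1 - \<alpha>) * fst \<sigma>' u * A u v / wdeg E A u"
        using y alpha_less A_nonneg[OF uv] wdeg_pos[OF uv(1)]
        by (intro divide_right_mono mult_right_mono mult_left_mono) (auto simp: q')
      then show ?thesis using False R by (auto simp: residue_def Q')
    qed
  qed
  ultimately show ?thesis by (simp add: ep_invariant_def)
qed

text \<open>The potential \<open>\<Sum> Q / \<theta>\<close> starts at 0, and each push adds
  \<open>y / \<theta>\<close>, which is at least 1 by eligibility.\<close>

lemma push_count_le:
  assumes s: "s \<in> V"
    and pos: "\<And>u v. (u, v) \<in> dir_edges E \<Longrightarrow> 0 < \<theta> u v"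
    and run: "(ep_step E A \<alpha> \<theta> ^^ k) (ep_init s) \<sigma>"
  shows "ep_invariant s \<sigma> \<and> real k \<le> (\<Sum>(u, v)\<in>dir_edges E. snd \<sigma> u v / \<theta> u v)"
  using run
proof (induction k arbitrary: \<sigma>)
  case 0
  then show ?case using ep_invariant_init[OF s] by (auto simp: ep_init_def case_prod_beta)
next
  case (Suc k)
  then obtain \<tau> where \<tau>: "(ep_step E A \<alpha> \<theta> ^^ k) (ep_init s) \<tau>" and step: "ep_step E A \<alpha> \<theta> \<tau> \<sigma>"
    by auto
  obtain a b where ab: "(a, b) \<in> dir_edges E" "\<theta> a b \<le> residue E A \<alpha> \<tau> a b"
    and \<sigma>: "\<sigma> = push_edge a b (residue E A \<alpha> \<tau> a b) \<tau>"
    using step by (auto simp: ep_step_def eligible_def)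
  have Q: "snd \<sigma> u v / \<theta> u v
      = snd \<tau> u v / \<theta> u v + (if (u, v) = (a, b) then residue E A \<alpha> \<tau> a b / \<theta> a b else 0)" for u v
    by (auto simp: \<sigma> push_edge_def add_divide_distrib)
  have "(\<Sum>(u, v)\<in>dir_edges E. snd \<sigma> u v / \<theta> u v)
      = (\<Sum>(u, v)\<in>dir_edges E. snd \<tau> u v / \<theta> u v) + residue E A \<alpha> \<tau> a b / \<theta> a b"
    unfolding Q case_prod_beta sum.distrib using ab(1) finite_dir_edges by simp
  moreover have "1 \<le> residue E A \<alpha> \<tau> a b / \<theta> a b"
    using ab pos[OF ab(1)] by simp
  ultimately show ?case
    using Suc.IH[OF \<tau>] ep_invariant_step[OF _ pos step] by auto
qed

section \<open>The approximation error\<close>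

text \<open>Conservation expresses the expenses flowing into \<open>t\<close> through its income,
  turning the definition of the residue into a PageRank-type equation for \<open>q\<close>.
  Subtracting \<alpha> times it from the equation of \<open>ppr\<close> cancels the source.\<close>

lemma error_equation:
  assumes s: "s \<in> V" and inv: "ep_invariant s \<sigma>" and t: "t \<in> V"
  shows "ppr V E A \<alpha> s t - \<alpha> * fst \<sigma> t
    = (1 - \<alpha>) * (\<Sum>u\<in>V. P t u * (ppr V E A \<alpha> s u - \<alpha> * fst \<sigma> u))
      + \<alpha> * (\<Sum>u\<in>V. residue E A \<alpha> \<sigma> u t)"
proof -
  \<comment> \<open>The residue contains \<open>A u t\<close> while \<open>P t u\<close> contains
    \<open>A t u\<close>; symmetry of \<open>A\<close> identifies them.\<close>
  have "(\<Sum>u\<in>V. residue E A \<alpha> \<sigma> u t)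
      = (\<Sum>u\<in>V. (1 - \<alpha>) * (P t u * fst \<sigma> u) - snd \<sigma> u t)"
    by (rule sum.cong) (simp_all add: residue_def transition_def A_sym[OF t] mult_ac)
  also have "\<dots> = (1 - \<alpha>) * (\<Sum>u\<in>V. P t u * fst \<sigma> u) - (\<Sum>u\<in>V. snd \<sigma> u t)"
    by (simp add: sum_subtractf sum_distrib_left)
  finally have "fst \<sigma> t = of_bool (t = s) + (1 - \<alpha>) * (\<Sum>u\<in>V. P t u * fst \<sigma> u)
      - (\<Sum>u\<in>V. residue E A \<alpha> \<sigma> u t)"
    using inv t by (simp add: ep_invariant_def)
  then have "\<alpha> * fst \<sigma> t = \<alpha> * (of_bool (t = s) + (1 - \<alpha>) * (\<Sum>u\<in>V. P t u * fst \<sigma> u)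
      - (\<Sum>u\<in>V. residue E A \<alpha> \<sigma> u t))" by simp
  moreover have "(\<Sum>u\<in>V. P t u * (ppr V E A \<alpha> s u - \<alpha> * fst \<sigma> u))
      = (\<Sum>u\<in>V. P t u * ppr V E A \<alpha> s u) - \<alpha> * (\<Sum>u\<in>V. P t u * fst \<sigma> u)"
    by (simp add: right_diff_distrib sum_subtractf sum_distrib_left mult_ac)
  ultimately show ?thesis
    by (simp only: ppr_equation[OF s t]) (simp add: algebra_simps)
qed

text \<open>Nonnegative residues make the error a supersolution, so EdgePush underestimates every
  entry.\<close>

lemma income_le_ppr:
  assumes s: "s \<in> V" and inv: "ep_invariant s \<sigma>" and t: "t \<in> V"
  shows "\<alpha> * fst \<sigma> t \<le> ppr V E A \<alpha> s t"
proof -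
  have "0 \<le> ppr V E A \<alpha> s t - \<alpha> * fst \<sigma> t"
  proof (rule supersolution_nonneg[OF _ t])
    fix t assume t: "t \<in> V"
    have "0 \<le> \<alpha> * (\<Sum>u\<in>V. residue E A \<alpha> \<sigma> u t)"
      using inv t alpha_pos
      by (intro mult_nonneg_nonneg sum_nonneg) (auto simp: ep_invariant_def)
    with error_equation[OF s inv t]
    show "(1 - \<alpha>) * (\<Sum>u\<in>V. P t u * (ppr V E A \<alpha> s u - \<alpha> * fst \<sigma> u))
      \<le> ppr V E A \<alpha> s t - \<alpha> * fst \<sigma> t" by simp
  qed
  then show ?thesis by simp
qed

text \<open>The error is nonnegative, so its norm is its plain sum S. Summing the error equation
  gives S = (1 - \<alpha>) S + \<alpha> R with R the total residue, hence S = R.\<close>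

lemma l1_error_eq_total_residue:
  assumes s: "s \<in> V" and inv: "ep_invariant s \<sigma>"
  shows "(\<Sum>t\<in>V. \<bar>\<alpha> * fst \<sigma> t - ppr V E A \<alpha> s t\<bar>)
    = (\<Sum>(u, v)\<in>dir_edges E. residue E A \<alpha> \<sigma> u v)"
proof -
  let ?d = "\<lambda>t. ppr V E A \<alpha> s t - \<alpha> * fst \<sigma> t"
  let ?r = "\<lambda>t. \<Sum>u\<in>V. residue E A \<alpha> \<sigma> u t"
  have "(\<Sum>t\<in>V. ?d t) = (\<Sum>t\<in>V. (1 - \<alpha>) * (\<Sum>u\<in>V. P t u * ?d u) + \<alpha> * ?r t)"
    by (rule sum.cong[OF refl error_equation[OF s inv]])
  also have "\<dots> = (1 - \<alpha>) * (\<Sum>t\<in>V. ?d t) + \<alpha> * (\<Sum>t\<in>V. ?r t)"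
    by (simp only: sum.distrib sum_distrib_left[symmetric] P_preserves_mass)
  finally have "\<alpha> * (\<Sum>t\<in>V. ?d t) = \<alpha> * (\<Sum>t\<in>V. ?r t)"
    unfolding left_diff_distrib by linarith
  then have "(\<Sum>t\<in>V. ?d t) = (\<Sum>t\<in>V. ?r t)" using alpha_pos by simp
  also have "\<dots> = (\<Sum>(u, v)\<in>dir_edges E. residue E A \<alpha> \<sigma> u v)"
    \<comment> \<open>Off the edges both \<open>A\<close> and the expenses vanish, so the residue
      there is 0.\<close>
    by (subst sum.swap, rule sum_dir_edges_eq_sum_V[symmetric])
      (use inv in \<open>simp add: residue_def A_no_edge ep_invariant_def\<close>)
  finally show ?thesis
    using income_le_ppr[OF s inv] by (simp add: abs_minus_commute)
qed

section \<open>Number of pushes and running time\<close>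

text \<open>The bound is independent of the order of pushes and linear in the PageRank vector of
  \<open>s\<close>. The former yields termination, the latter allows averaging over sources.\<close>

lemma push_count_le_ppr:
  assumes s: "s \<in> V"
    and pos: "\<And>u v. (u, v) \<in> dir_edges E \<Longrightarrow> 0 < \<theta> u v"
    and run: "(ep_step E A \<alpha> \<theta> ^^ k) (ep_init s) \<sigma>"
  shows "real k \<le> (\<Sum>(u, v)\<in>dir_edges E.
    (1 - \<alpha>) / \<alpha> * ppr V E A \<alpha> s u * A u v / (wdeg E A u * \<theta> u v))"
proof -
  have inv: "ep_invariant s \<sigma>"
    and k: "real k \<le> (\<Sum>(u, v)\<in>dir_edges E. snd \<sigma> u v / \<theta> u v)"
    using push_count_le[where \<theta> = \<theta>, OF s pos run] by auto
  have "snd \<sigma> u v / \<theta> u v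
      \<le> (1 - \<alpha>) / \<alpha> * ppr V E A \<alpha> s u * A u v / (wdeg E A u * \<theta> u v)"
    if e: "(u, v) \<in> dir_edges E" for u v
  proof -
    have V: "u \<in> V" "v \<in> V" using edge_in_V[OF e] by auto
    have "0 \<le> residue E A \<alpha> \<sigma> u v"
      using inv V by (simp add: ep_invariant_def)
    then have "snd \<sigma> u v \<le> (1 - \<alpha>) * fst \<sigma> u * A u v / wdeg E A u"
      by (simp add: residue_def)
    also have "\<dots> \<le> (1 - \<alpha>) * (ppr V E A \<alpha> s u / \<alpha>) * A u v / wdeg E A u"
      using income_le_ppr[OF s inv V(1)] alpha_pos alpha_less A_nonneg[OF V] wdeg_pos[OF V(1)]
      by (intro divide_right_mono mult_right_mono mult_left_mono)
        (auto simp: pos_le_divide_eq mult_ac)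
    finally have "snd \<sigma> u v / \<theta> u v
        \<le> ((1 - \<alpha>) * (ppr V E A \<alpha> s u / \<alpha>) * A u v / wdeg E A u) / \<theta> u v"
      using pos[OF e] by (intro divide_right_mono) auto
    then show ?thesis by (simp add: mult_ac)
  qed
  then have "(\<Sum>(u, v)\<in>dir_edges E. snd \<sigma> u v / \<theta> u v) \<le> (\<Sum>(u, v)\<in>dir_edges E.
    (1 - \<alpha>) / \<alpha> * ppr V E A \<alpha> s u * A u v / (wdeg E A u * \<theta> u v))"
    by (intro sum_mono) auto
  with k show ?thesis by linarith
qed

text \<open>An infinite execution would have prefixes of every length, against a bound that depends
  only on \<open>s\<close>.\<close>

lemma edgepush_terminates:
  assumes s: "s \<in> V" and pos: "\<And>u v. (u, v) \<in> dir_edges E \<Longrightarrow> 0 < \<theta> u v"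
  shows "edgepush_terminates E A \<alpha> \<theta> s"
  unfolding edgepush_terminates_def
proof
  assume "\<exists>f. f 0 = ep_init s \<and> (\<forall>i. ep_step E A \<alpha> \<theta> (f i) (f (Suc i)))"
  then obtain f where f: "f 0 = ep_init s" "\<And>i. ep_step E A \<alpha> \<theta> (f i) (f (Suc i))"
    by auto
  have "(ep_step E A \<alpha> \<theta> ^^ k) (ep_init s) (f k)" for k
    by (induction k) (use f in auto)
  then have bound: "real k \<le> (\<Sum>(u, v)\<in>dir_edges E.
      (1 - \<alpha>) / \<alpha> * ppr V E A \<alpha> s u * A u v / (wdeg E A u * \<theta> u v))" (is "_ \<le> ?B") for k
    using push_count_le_ppr[where \<theta> = \<theta>, OF s pos] by blast
  obtain n :: nat where "?B < real n" using reals_Archimedean2 by blast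
  with bound[of n] show False by linarith
qed

lemma edgepush_output_l1_error:
  assumes s: "s \<in> V" and pos: "\<And>u v. (u, v) \<in> dir_edges E \<Longrightarrow> 0 < \<theta> u v"
    and out: "edgepush_output E A \<alpha> \<theta> s p"
  shows "(\<Sum>t\<in>V. \<bar>p t - ppr V E A \<alpha> s t\<bar>) \<le> (\<Sum>(u, v)\<in>dir_edges E. \<theta> u v)"
proof -
  obtain k \<sigma> where run: "(ep_step E A \<alpha> \<theta> ^^ k) (ep_init s) \<sigma>"
    and stop: "\<nexists>u v. eligible E A \<alpha> \<theta> \<sigma> u v" and p: "p = (\<lambda>t. \<alpha> * fst \<sigma> t)"
    using out by (auto simp: edgepush_output_def edgepush_run_def)
  have inv: "ep_invariant s \<sigma>" using push_count_le[where \<theta> = \<theta>, OF s pos run] by simp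
  have "(\<Sum>t\<in>V. \<bar>p t - ppr V E A \<alpha> s t\<bar>) = (\<Sum>(u, v)\<in>dir_edges E. residue E A \<alpha> \<sigma> u v)"
    unfolding p by (rule l1_error_eq_total_residue[OF s inv])
  also have "\<dots> \<le> (\<Sum>(u, v)\<in>dir_edges E. \<theta> u v)"
    using stop by (intro sum_mono) (auto simp: eligible_def not_le less_imp_le)
  finally show ?thesis .
qed

text \<open>After exchanging the sums, stationarity evaluates the inner sum over sources to the
  degree of \<open>u\<close>, which cancels the degree in the denominator.\<close>

lemma degree_weighted_push_count_le:
  assumes pos: "\<And>u v. (u, v) \<in> dir_edges E \<Longrightarrow> 0 < \<theta> u v"
    and run: "\<And>s. s \<in> V \<Longrightarrow> (ep_step E A \<alpha> \<theta> ^^ k s) (ep_init s) (\<sigma> s)"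
  shows "(\<Sum>s\<in>V. wdeg E A s * real (k s))
    \<le> (1 - \<alpha>) / \<alpha> * (\<Sum>(u, v)\<in>dir_edges E. A u v / \<theta> u v)"
proof -
  let ?B = "\<lambda>u v. (1 - \<alpha>) / \<alpha> * A u v / (wdeg E A u * \<theta> u v)"
  have "(\<Sum>s\<in>V. wdeg E A s * real (k s))
      \<le> (\<Sum>s\<in>V. wdeg E A s * (\<Sum>(u, v)\<in>dir_edges E.
          (1 - \<alpha>) / \<alpha> * ppr V E A \<alpha> s u * A u v / (wdeg E A u * \<theta> u v)))"
    using push_count_le_ppr[where \<theta> = \<theta>, OF _ pos run] wdeg_pos
    by (intro sum_mono mult_left_mono) (auto simp: less_imp_le)
  also have "\<dots> = (\<Sum>s\<in>V. \<Sum>(u, v)\<in>dir_edges E.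
      ?B u v * (wdeg E A s * ppr V E A \<alpha> s u))"
    by (simp add: sum_distrib_left case_prod_beta mult_ac)
  also have "\<dots> = (\<Sum>(u, v)\<in>dir_edges E. ?B u v * (\<Sum>s\<in>V. wdeg E A s * ppr V E A \<alpha> s u))"
    by (subst sum.swap) (simp add: sum_distrib_left case_prod_beta)
  also have "\<dots> = (\<Sum>(u, v)\<in>dir_edges E. (1 - \<alpha>) / \<alpha> * (A u v / \<theta> u v))"
  proof (rule sum.cong[OF refl], clarify)
    fix u v assume "(u, v) \<in> dir_edges E"
    then have u: "u \<in> V" using edge_in_V by blast
    show "?B u v * (\<Sum>s\<in>V. wdeg E A s * ppr V E A \<alpha> s u) = (1 - \<alpha>) / \<alpha> * (A u v / \<theta> u v)"
      using wdeg_pos[OF u] by (simp add: ppr_degree_stationary[OF u])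
  qed
  also have "\<dots> = (1 - \<alpha>) / \<alpha> * (\<Sum>(u, v)\<in>dir_edges E. A u v / \<theta> u v)"
    by (simp add: sum_distrib_left case_prod_beta)
  finally show ?thesis .
qed

lemma expected_running_time_le:
  assumes pos: "\<And>u v. (u, v) \<in> dir_edges E \<Longrightarrow> 0 < \<theta> u v"
    and c: "0 \<le> c"
    and T: "\<And>s. s \<in> V \<Longrightarrow> edgepush_running_time c E A \<alpha> \<theta> s (T s)"
  shows "measure_pmf.expectation (degree_pmf V E A) T
    \<le> c * ((1 - \<alpha>) / (\<alpha> * adj_norm1 E A) * (\<Sum>(u, v)\<in>dir_edges E. A u v / \<theta> u v))"
proof -
  \<comment> \<open>Runs are nondeterministic, so one run accounting for the time \<open>T s\<close>
    is chosen for each source.\<close>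
  have "\<exists>k \<sigma>. (ep_step E A \<alpha> \<theta> ^^ k) (ep_init s) \<sigma> \<and> T s \<le> c * real k" if "s \<in> V" for s
    using T[OF that] by (auto simp: edgepush_running_time_def edgepush_run_def)
  then obtain k \<sigma> where run: "\<And>s. s \<in> V \<Longrightarrow> (ep_step E A \<alpha> \<theta> ^^ k s) (ep_init s) (\<sigma> s)"
    and time: "\<And>s. s \<in> V \<Longrightarrow> T s \<le> c * real (k s)"
    by metis
  have "(\<Sum>s\<in>V. wdeg E A s * T s) \<le> (\<Sum>s\<in>V. wdeg E A s * (c * real (k s)))"
    using time wdeg_pos by (intro sum_mono mult_left_mono) (auto simp: less_imp_le)
  also have "\<dots> = c * (\<Sum>s\<in>V. wdeg E A s * real (k s))"
    by (simp add: sum_distrib_left mult_ac)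
  also have "\<dots> \<le> c * ((1 - \<alpha>) / \<alpha> * (\<Sum>(u, v)\<in>dir_edges E. A u v / \<theta> u v))"
    using degree_weighted_push_count_le[where \<theta> = \<theta>, OF pos run] c
    by (intro mult_left_mono) auto
  finally have "(\<Sum>s\<in>V. wdeg E A s * T s) / adj_norm1 E A
      \<le> c * ((1 - \<alpha>) / \<alpha> * (\<Sum>(u, v)\<in>dir_edges E. A u v / \<theta> u v)) / adj_norm1 E A"
    using adj_norm1_pos by (intro divide_right_mono) auto
  then show ?thesis
    by (simp add: expectation_degree_pmf mult_ac)
qed

end

section \<open>The square-root thresholds\<close>

lemma edgepush_instance_pagerank_graph:
  "edgepush_instance V E A \<alpha> \<epsilon> \<Longrightarrow> pagerank_graph V E A \<alpha>"
  by (simp add: edgepush_instance_def pagerank_graph_def)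

lemma edgepush_instance_threshold_pos:
  "edgepush_instance V E A \<alpha> \<epsilon> \<Longrightarrow> (u, v) \<in> dir_edges E \<Longrightarrow> 0 < sqrt_threshold E A \<epsilon> u v"
  by (auto simp: edgepush_instance_def)

text \<open>Division by zero makes the sum \<open>0\<close> if \<open>sqrt_sum E A = 0\<close>.\<close>

lemma sum_sqrt_threshold_le:
  "0 \<le> \<epsilon> \<Longrightarrow> (\<Sum>(u, v)\<in>dir_edges E. sqrt_threshold E A \<epsilon> u v) \<le> \<epsilon>"
proof -
  assume "0 \<le> \<epsilon>"
  have "(\<Sum>(u, v)\<in>dir_edges E. sqrt_threshold E A \<epsilon> u v) = \<epsilon> * sqrt_sum E A / sqrt_sum E A"
    by (simp add: sqrt_threshold_def sqrt_sum_def[of E A] sum_distrib_left sum_divide_distrib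
        case_prod_beta)
  with \<open>0 \<le> \<epsilon>\<close> show ?thesis by simp
qed

text \<open>Each term is \<open>sqrt (A u v)\<close> times the constant
  \<open>sqrt_sum E A / \<epsilon>\<close>. By Cauchy-Schwarz, thresholds proportional to
  \<open>sqrt (A u v)\<close> minimise this cost among positive thresholds of total
  \<epsilon>.\<close>

lemma sum_weight_div_sqrt_threshold:
  assumes "\<And>u v. (u, v) \<in> dir_edges E \<Longrightarrow> 0 \<le> A u v"
  shows "(\<Sum>(u, v)\<in>dir_edges E. A u v / sqrt_threshold E A \<epsilon> u v) = (sqrt_sum E A)\<^sup>2 / \<epsilon>"
proof -
  have "(\<Sum>(u, v)\<in>dir_edges E. A u v / sqrt_threshold E A \<epsilon> u v)
      = (\<Sum>(u, v)\<in>dir_edges E. sqrt (A u v) * (sqrt_sum E A / \<epsilon>))"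
  proof (rule sum.cong[OF refl], clarify)
    fix u v assume "(u, v) \<in> dir_edges E"
    \<comment> \<open>This includes weight 0, where division by zero yields 0.\<close>
    then have "A u v / sqrt (A u v) = sqrt (A u v)"
      using assms by (simp add: real_div_sqrt)
    then have "A u v / sqrt (A u v) * (sqrt_sum E A / \<epsilon>) = sqrt (A u v) * (sqrt_sum E A / \<epsilon>)"
      by simp
    then show "A u v / sqrt_threshold E A \<epsilon> u v = sqrt (A u v) * (sqrt_sum E A / \<epsilon>)"
      by (simp add: sqrt_threshold_def mult_ac)
  qed
  also have "\<dots> = sqrt_sum E A * (sqrt_sum E A / \<epsilon>)"
    unfolding sqrt_sum_def[of E A] sum_distrib_right by (intro sum.cong) auto
  finally show ?thesis by (simp add: power2_eq_square)
qed

theorem theorem5p4: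
  shows "(\<forall>(V :: 'v set) E A \<alpha> \<epsilon>. \<forall>s\<in>V.
            edgepush_instance V E A \<alpha> \<epsilon> \<longrightarrow>
              edgepush_terminates E A \<alpha> (sqrt_threshold E A \<epsilon>) s \<and>
              (\<forall>p. edgepush_output E A \<alpha> (sqrt_threshold E A \<epsilon>) s p \<longrightarrow>
                 (\<Sum>t\<in>V. \<bar>p t - ppr V E A \<alpha> s t\<bar>) \<le> \<epsilon>))
       \<and> (\<forall>c\<ge>0. \<exists>C>0. \<forall>(V :: 'v set) E A \<alpha> \<epsilon> T.
            edgepush_instance V E A \<alpha> \<epsilon> \<longrightarrow>
            (\<forall>s\<in>V. edgepush_running_time c E A \<alpha> (sqrt_threshold E A \<epsilon>) s (T s)) \<longrightarrow>
              measure_pmf.expectation (degree_pmf V E A) T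
                \<le> C * ((1 - \<alpha>) / (\<alpha> * \<epsilon> * adj_norm1 E A) * (sqrt_sum E A)\<^sup>2))"
proof (rule conjI)
  show "\<forall>(V :: 'v set) E A \<alpha> \<epsilon>. \<forall>s\<in>V.
            edgepush_instance V E A \<alpha> \<epsilon> \<longrightarrow>
              edgepush_terminates E A \<alpha> (sqrt_threshold E A \<epsilon>) s \<and>
              (\<forall>p. edgepush_output E A \<alpha> (sqrt_threshold E A \<epsilon>) s p \<longrightarrow>
                 (\<Sum>t\<in>V. \<bar>p t - ppr V E A \<alpha> s t\<bar>) \<le> \<epsilon>)"
  proof (intro allI ballI impI conjI)
    fix V :: "'v set" and E A \<alpha> \<epsilon> s
    assume s: "s \<in> V" and inst: "edgepush_instance V E A \<alpha> \<epsilon>"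
    interpret pagerank_graph V E A \<alpha> by (rule edgepush_instance_pagerank_graph[OF inst])
    note pos = edgepush_instance_threshold_pos[OF inst]
    show "edgepush_terminates E A \<alpha> (sqrt_threshold E A \<epsilon>) s"
      by (rule edgepush_terminates[OF s pos])
    fix p
    assume "edgepush_output E A \<alpha> (sqrt_threshold E A \<epsilon>) s p"
    then have "(\<Sum>t\<in>V. \<bar>p t - ppr V E A \<alpha> s t\<bar>)
        \<le> (\<Sum>(u, v)\<in>dir_edges E. sqrt_threshold E A \<epsilon> u v)"
      by (intro edgepush_output_l1_error[OF s] pos)
    also have "\<dots> \<le> \<epsilon>"
      using inst by (intro sum_sqrt_threshold_le) (simp add: edgepush_instance_def)
    finally show "(\<Sum>t\<in>V. \<bar>p t - ppr V E A \<alpha> s t\<bar>) \<le> \<epsilon>" .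
  qed
next
  show "\<forall>c\<ge>0. \<exists>C>0. \<forall>(V :: 'v set) E A \<alpha> \<epsilon> T.
            edgepush_instance V E A \<alpha> \<epsilon> \<longrightarrow>
            (\<forall>s\<in>V. edgepush_running_time c E A \<alpha> (sqrt_threshold E A \<epsilon>) s (T s)) \<longrightarrow>
              measure_pmf.expectation (degree_pmf V E A) T
                \<le> C * ((1 - \<alpha>) / (\<alpha> * \<epsilon> * adj_norm1 E A) * (sqrt_sum E A)\<^sup>2)"
  proof (intro allI impI)
    fix c :: real assume c: "0 \<le> c"
    show "\<exists>C>0. \<forall>(V :: 'v set) E A \<alpha> \<epsilon> T.
            edgepush_instance V E A \<alpha> \<epsilon> \<longrightarrow>
            (\<forall>s\<in>V. edgepush_running_time c E A \<alpha> (sqrt_threshold E A \<epsilon>) s (T s)) \<longrightarrow>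
              measure_pmf.expectation (degree_pmf V E A) T
                \<le> C * ((1 - \<alpha>) / (\<alpha> * \<epsilon> * adj_norm1 E A) * (sqrt_sum E A)\<^sup>2)"
    \<comment> \<open>The constant must be strictly positive although \<open>c\<close> may be 0; it
      depends on \<open>c\<close> alone.\<close>
    proof (intro exI[of _ "c + 1"] conjI allI impI)
      show "0 < c + 1" using c by simp
      fix V :: "'v set" and E A \<alpha> \<epsilon> T
      assume inst: "edgepush_instance V E A \<alpha> \<epsilon>"
        and T: "\<forall>s\<in>V. edgepush_running_time c E A \<alpha> (sqrt_threshold E A \<epsilon>) s (T s)"
      interpret pagerank_graph V E A \<alpha> by (rule edgepush_instance_pagerank_graph[OF inst])
      note pos = edgepush_instance_threshold_pos[OF inst]
      let ?B = "(1 - \<alpha>) / (\<alpha> * \<epsilon> * adj_norm1 E A) * (sqrt_sum E A)\<^sup>2"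
      have "measure_pmf.expectation (degree_pmf V E A) T
          \<le> c * ((1 - \<alpha>) / (\<alpha> * adj_norm1 E A) *
              (\<Sum>(u, v)\<in>dir_edges E. A u v / sqrt_threshold E A \<epsilon> u v))"
        by (rule expected_running_time_le[OF pos c]) (use T in auto)
      also have "\<dots> = c * ?B"
        using edge_in_V A_nonneg
        by (subst sum_weight_div_sqrt_threshold) (auto simp: mult_ac)
      also have "\<dots> \<le> (c + 1) * ?B"
        using inst adj_norm1_pos
        by (intro mult_right_mono) (auto simp: edgepush_instance_def)
      finally show "measure_pmf.expectation (degree_pmf V E A) T \<le> (c + 1) * ?B" .
    qed
  qed
qed

end
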